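(* For any two objects $(C,x)$ and $(D,y)$ of $\Omega$, the hom set $\mathrm{Hom}_{\Omega}((C,x),(D,y))$ is non-empty.
   Context: Fix Grothendieck universes $U\in U'$. Objects of $\Omega$ are pairs $(C,x)$ with $C$ a $U$-small category and $x\in Ob(C)$. An arrow $(C,x)\to(D,y)$ in $\Omega$ is an equivalence class $[(F,\phi)]$ of pairs, $F : C^{op}\times D\to U\text{-}\mathbf{Set}$ a functor and $\phi\in F(x,y)$, where $(F,\phi)\equiv(G,\psi)$ iff there is a natural isomorphism $\Phi : F\to G$ with $\Phi(x,y)(\phi)=\psi$. *)

theory Defs
  imports Main "HOL-Library.FuncSet"
begin

(* Ambient set theory: every value of the type is a set, elts gives its elements. The remaining
   axioms of set theory are not needed here, since a Grothendieck universe supplies them for its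
   own elements. *)
class set_theory =
  fixes elts :: "'a \<Rightarrow> 'a set"
  assumes extensionality: "elts x = elts y \<Longrightarrow> x = y"
    and foundation: "wf {(x, y). x \<in> elts y}"

(* The SGA 4 definition. The existence of an infinite element is not required. A family (f i),
   i in I, of elements of U is any HOL function on I. *)
definition grothendieck_universe :: "'v::set_theory \<Rightarrow> bool" where
  "grothendieck_universe U \<longleftrightarrow>
     elts U \<noteq> {} \<and>
     (\<forall>x\<in>elts U. elts x \<subseteq> elts U) \<and>
     (\<forall>x\<in>elts U. \<forall>y\<in>elts U. \<exists>z\<in>elts U. elts z = {x, y}) \<and>
     (\<forall>x\<in>elts U. \<exists>z\<in>elts U. elts z = {w. elts w \<subseteq> elts x}) \<and>
     (\<forall>I\<in>elts U. \<forall>f. f ` elts I \<subseteq> elts U \<longrightarrow>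
        (\<exists>z\<in>elts U. elts z = (\<Union>i\<in>elts I. elts (f i))))"

record ('o, 'm) cat =
  Obj :: "'o set"
  Arr :: "'m set"
  Dom :: "'m \<Rightarrow> 'o"
  Cod :: "'m \<Rightarrow> 'o"
  Ident :: "'o \<Rightarrow> 'm"
  Comp :: "'m \<Rightarrow> 'm \<Rightarrow> 'm"

definition hom :: "('o, 'm) cat \<Rightarrow> 'o \<Rightarrow> 'o \<Rightarrow> 'm set" where
  "hom C a b = {f \<in> Arr C. Dom C f = a \<and> Cod C f = b}"

(* Comp C g f is "g after f". All structure maps take the value undefined outside their domain of
   definition, so that equality of categories is not affected by irrelevant values. *)
definition category :: "('o, 'm) cat \<Rightarrow> bool" where
  "category C \<longleftrightarrow>
     Dom C \<in> Arr C \<rightarrow>\<^sub>E Obj C \<and>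
     Cod C \<in> Arr C \<rightarrow>\<^sub>E Obj C \<and>
     Ident C \<in> extensional (Obj C) \<and>
     (\<forall>a\<in>Obj C. Ident C a \<in> hom C a a) \<and>
     (\<forall>f\<in>Arr C. \<forall>g\<in>Arr C. Cod C f = Dom C g \<longrightarrow> Comp C g f \<in> hom C (Dom C f) (Cod C g)) \<and>
     (\<forall>f g. \<not> (f \<in> Arr C \<and> g \<in> Arr C \<and> Cod C f = Dom C g) \<longrightarrow> Comp C g f = undefined) \<and>
     (\<forall>f\<in>Arr C. Comp C f (Ident C (Dom C f)) = f \<and> Comp C (Ident C (Cod C f)) f = f) \<and>
     (\<forall>f\<in>Arr C. \<forall>g\<in>Arr C. \<forall>h\<in>Arr C. Cod C f = Dom C g \<longrightarrow> Cod C g = Dom C h \<longrightarrow>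
        Comp C h (Comp C g f) = Comp C (Comp C h g) f)"

definition op_cat :: "('o, 'm) cat \<Rightarrow> ('o, 'm) cat" where
  "op_cat C =
     \<lparr>Obj = Obj C, Arr = Arr C, Dom = Cod C, Cod = Dom C, Ident = Ident C,
      Comp = (\<lambda>g f. Comp C f g)\<rparr>"

lemma category_op_cat: "category C \<Longrightarrow> category (op_cat C)"
  unfolding category_def op_cat_def hom_def by (auto simp: PiE_iff)

definition prod_cat :: "('o, 'm) cat \<Rightarrow> ('p, 'n) cat \<Rightarrow> ('o \<times> 'p, 'm \<times> 'n) cat" where
  "prod_cat C D =
     \<lparr>Obj = Obj C \<times> Obj D,
      Arr = Arr C \<times> Arr D,
      Dom = restrict (map_prod (Dom C) (Dom D)) (Arr C \<times> Arr D),
      Cod = restrict (map_prod (Cod C) (Cod D)) (Arr C \<times> Arr D),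
      Ident = restrict (map_prod (Ident C) (Ident D)) (Obj C \<times> Obj D),
      Comp = (\<lambda>g f.
        if f \<in> Arr C \<times> Arr D \<and> g \<in> Arr C \<times> Arr D \<and>
           Cod C (fst f) = Dom C (fst g) \<and> Cod D (snd f) = Dom D (snd g)
        then (Comp C (fst g) (fst f), Comp D (snd g) (snd f)) else undefined)\<rparr>"

lemma category_prod_cat: "category C \<Longrightarrow> category D \<Longrightarrow> category (prod_cat C D)"
  unfolding category_def prod_cat_def hom_def
  by (auto simp: PiE_iff restrict_def extensional_def)

(* A map of sets together with its source and target. *)
datatype 'v set_map = Set_Map (src: 'v) (app: "'v \<Rightarrow> 'v") (tgt: 'v)

definition set_cat :: "'v::set_theory \<Rightarrow> ('v, 'v set_map) cat" where
  "set_cat U =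
     (let M = {f. src f \<in> elts U \<and> tgt f \<in> elts U \<and> app f \<in> elts (src f) \<rightarrow>\<^sub>E elts (tgt f)}
      in \<lparr>Obj = elts U,
          Arr = M,
          Dom = restrict src M,
          Cod = restrict tgt M,
          Ident = (\<lambda>A\<in>elts U. Set_Map A (\<lambda>a\<in>elts A. a) A),
          Comp = (\<lambda>g f.
            if f \<in> M \<and> g \<in> M \<and> tgt f = src g
            then Set_Map (src f) (\<lambda>a\<in>elts (src f). app g (app f a)) (tgt g) else undefined)\<rparr>)"

lemma category_set_cat: "category (set_cat U)"
proof -
  define M where "M = {f :: 'a set_map. src f \<in> elts U \<and> tgt f \<in> elts U \<and>
    app f \<in> elts (src f) \<rightarrow>\<^sub>E elts (tgt f)}"
  have mem: "src f \<in> elts U" "tgt f \<in> elts U" if "f \<in> M" for f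
    using that by (auto simp: M_def)
  have app: "app f a \<in> elts (tgt f)" if "f \<in> M" "a \<in> elts (src f)" for f a
    using that by (auto simp: M_def)
  have ident: "Set_Map A (\<lambda>a\<in>elts A. a) A \<in> M" if "A \<in> elts U" for A
    using that by (auto simp: M_def)
  have comp: "Set_Map (src f) (\<lambda>a\<in>elts (src f). app g (app f a)) B \<in> M"
    if "f \<in> M" "g \<in> M" "tgt f = src g" "tgt g = B" for f g B
    using that by (auto simp: M_def PiE_iff)
  have eta: "Set_Map (src f) (\<lambda>a\<in>elts (src f). app f a) (tgt f) = f" if "f \<in> M" for f
    using that by (cases f) (simp add: M_def PiE_iff extensional_restrict)
  have "(\<lambda>a\<in>elts (src f). app f (if a \<in> elts (src f) then a else undefined)) =
      (\<lambda>a\<in>elts (src f). app f a)" for f :: "'a set_map"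
    by (rule restrict_ext) simp
  moreover have "(\<lambda>a\<in>elts (src f). if app f a \<in> elts (tgt f) then app f a else undefined) =
      (\<lambda>a\<in>elts (src f). app f a)" if "f \<in> M" for f
    by (rule restrict_ext) (simp add: app that)
  moreover have
    "(\<lambda>a\<in>elts (src f). app h (if a \<in> elts (src f) then app g (app f a) else undefined)) =
     (\<lambda>a\<in>elts (src f). if app f a \<in> elts (src g) then app h (app g (app f a)) else undefined)"
    if "f \<in> M" "tgt f = src g" for f g h
    by (rule restrict_ext) (use app[OF that(1)] that(2) in simp)
  ultimately show ?thesis
    unfolding category_def set_cat_def hom_def Let_def M_def[symmetric]
    by (simp add: mem ident comp eta)
qed

record ('o, 'm, 'p, 'n) cat_functor =
  ObjMap :: "'o \<Rightarrow> 'p"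
  ArrMap :: "'m \<Rightarrow> 'n"

definition is_functor ::
    "('o, 'm) cat \<Rightarrow> ('p, 'n) cat \<Rightarrow> ('o, 'm, 'p, 'n) cat_functor \<Rightarrow> bool" where
  "is_functor C D F \<longleftrightarrow>
     category C \<and> category D \<and>
     ObjMap F \<in> Obj C \<rightarrow>\<^sub>E Obj D \<and>
     ArrMap F \<in> extensional (Arr C) \<and>
     (\<forall>f\<in>Arr C. ArrMap F f \<in> hom D (ObjMap F (Dom C f)) (ObjMap F (Cod C f))) \<and>
     (\<forall>a\<in>Obj C. ArrMap F (Ident C a) = Ident D (ObjMap F a)) \<and>
     (\<forall>f\<in>Arr C. \<forall>g\<in>Arr C. Cod C f = Dom C g \<longrightarrow>
        ArrMap F (Comp C g f) = Comp D (ArrMap F g) (ArrMap F f))"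

definition is_nat_trans ::
    "('o, 'm) cat \<Rightarrow> ('p, 'n) cat \<Rightarrow> ('o, 'm, 'p, 'n) cat_functor \<Rightarrow>
     ('o, 'm, 'p, 'n) cat_functor \<Rightarrow> ('o \<Rightarrow> 'n) \<Rightarrow> bool" where
  "is_nat_trans C D F G \<Phi> \<longleftrightarrow>
     is_functor C D F \<and> is_functor C D G \<and>
     \<Phi> \<in> extensional (Obj C) \<and>
     (\<forall>a\<in>Obj C. \<Phi> a \<in> hom D (ObjMap F a) (ObjMap G a)) \<and>
     (\<forall>f\<in>Arr C. Comp D (\<Phi> (Cod C f)) (ArrMap F f) = Comp D (ArrMap G f) (\<Phi> (Dom C f)))"

definition is_iso :: "('o, 'm) cat \<Rightarrow> 'm \<Rightarrow> bool" where
  "is_iso C f \<longleftrightarrow>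
     f \<in> Arr C \<and>
     (\<exists>g\<in>hom C (Cod C f) (Dom C f).
        Comp C g f = Ident C (Dom C f) \<and> Comp C f g = Ident C (Cod C f))"

definition is_nat_iso ::
    "('o, 'm) cat \<Rightarrow> ('p, 'n) cat \<Rightarrow> ('o, 'm, 'p, 'n) cat_functor \<Rightarrow>
     ('o, 'm, 'p, 'n) cat_functor \<Rightarrow> ('o \<Rightarrow> 'n) \<Rightarrow> bool" where
  "is_nat_iso C D F G \<Phi> \<longleftrightarrow> is_nat_trans C D F G \<Phi> \<and> (\<forall>a\<in>Obj C. is_iso D (\<Phi> a))"

(* The structure maps of such a category, being maps between elements of U, lie in U as well. *)
definition small_category :: "'v::set_theory \<Rightarrow> ('v, 'v) cat \<Rightarrow> bool" where
  "small_category U C \<longleftrightarrow>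
     category C \<and> (\<exists>ob\<in>elts U. elts ob = Obj C) \<and> (\<exists>ar\<in>elts U. elts ar = Arr C)"

type_synonym 'v pointed_cat = "('v, 'v) cat \<times> 'v"

type_synonym 'v pointed_prof =
  "('v \<times> 'v, 'v \<times> 'v, 'v, 'v set_map) cat_functor \<times> 'v"

definition Omega_Obj :: "'v::set_theory \<Rightarrow> 'v pointed_cat set" where
  "Omega_Obj U = {(C, x). small_category U C \<and> x \<in> Obj C}"

definition Omega_pre ::
    "'v::set_theory \<Rightarrow> 'v pointed_cat \<Rightarrow> 'v pointed_cat \<Rightarrow> 'v pointed_prof set" where
  "Omega_pre U = (\<lambda>(C, x) (D, y).
     {(F, \<phi>). is_functor (prod_cat (op_cat C) D) (set_cat U) F \<and> \<phi> \<in> elts (ObjMap F (x, y))})"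

definition Omega_equiv ::
    "'v::set_theory \<Rightarrow> 'v pointed_cat \<Rightarrow> 'v pointed_cat \<Rightarrow> ('v pointed_prof \<times> 'v pointed_prof) set"
  where
  "Omega_equiv U = (\<lambda>(C, x) (D, y).
     {((F, \<phi>), (G, \<psi>)).
        (F, \<phi>) \<in> Omega_pre U (C, x) (D, y) \<and> (G, \<psi>) \<in> Omega_pre U (C, x) (D, y) \<and>
        (\<exists>\<Phi>. is_nat_iso (prod_cat (op_cat C) D) (set_cat U) F G \<Phi> \<and> app (\<Phi> (x, y)) \<phi> = \<psi>)})"

definition Omega_Hom ::
    "'v::set_theory \<Rightarrow> 'v pointed_cat \<Rightarrow> 'v pointed_cat \<Rightarrow> 'v pointed_prof set set" where
  "Omega_Hom U X Y = Omega_pre U X Y // Omega_equiv U X Y"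

end

theory Submission
  imports Defs
begin

text \<open>
  An arrow \<open>(C, x) \<rightarrow> (D, y)\<close> is represented by a functor \<open>C\<^sup>o\<^sup>p \<times> D \<rightarrow> Set\<close> together with a point of
  its value at \<open>(x, y)\<close>, and nothing relates the functor to \<open>x\<close>, \<open>y\<close> or the hom sets of \<open>C\<close> and \<open>D\<close>.
  So any constant functor with a nonempty value gives an arrow. The value chosen here is a
  singleton, which exists in a Grothendieck universe because universes are nonempty and closed
  under pairing.
\<close>

definition const_functor ::
    "('o, 'm) cat \<Rightarrow> ('p, 'n) cat \<Rightarrow> 'p \<Rightarrow> ('o, 'm, 'p, 'n) cat_functor" where
  "const_functor C D b = \<lparr>ObjMap = (\<lambda>a\<in>Obj C. b), ArrMap = (\<lambda>f\<in>Arr C. Ident D b)\<rparr>"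

lemma is_functor_const_functor:
  assumes C: "category C" and D: "category D" and b: "b \<in> Obj D"
  shows "is_functor C D (const_functor C D b)"
proof -
  have id: "Ident D b \<in> hom D b b"
    using D b unfolding category_def by blast
  moreover have "\<forall>f\<in>Arr D. Comp D f (Ident D (Dom D f)) = f \<and> Comp D (Ident D (Cod D f)) f = f"
    using D unfolding category_def by (elim conjE)
  ultimately have idem: "Comp D (Ident D b) (Ident D b) = Ident D b"
    unfolding hom_def by fastforce
  have Dom: "Dom C \<in> Arr C \<rightarrow>\<^sub>E Obj C"
    using C unfolding category_def by (elim conjE)
  have Cod: "Cod C \<in> Arr C \<rightarrow>\<^sub>E Obj C"
    using C unfolding category_def by (elim conjE)
  have "\<forall>a\<in>Obj C. Ident C a \<in> hom C a a"
    using C unfolding category_def by (elim conjE)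
  then have ar: "Ident C a \<in> Arr C" if "a \<in> Obj C" for a
    using that by (simp add: hom_def)
  have "\<forall>f\<in>Arr C. \<forall>g\<in>Arr C. Cod C f = Dom C g \<longrightarrow> Comp C g f \<in> hom C (Dom C f) (Cod C g)"
    using C unfolding category_def by (elim conjE)
  then have comp: "Comp C g f \<in> Arr C" if "f \<in> Arr C" "g \<in> Arr C" "Cod C f = Dom C g" for f g
    using that by (simp add: hom_def)
  show ?thesis
    unfolding is_functor_def const_functor_def
    using C D by (simp add: b id idem PiE_mem[OF Dom] PiE_mem[OF Cod] ar comp)
qed

lemma grothendieck_universe_singleton:
  assumes "grothendieck_universe U"
  obtains A p where "A \<in> elts U" "elts A = {p}"
proof -
  have "elts U \<noteq> {}"
    using assms unfolding grothendieck_universe_def by (elim conjE)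
  then obtain p where "p \<in> elts U"
    by blast
  moreover have "\<forall>x\<in>elts U. \<forall>y\<in>elts U. \<exists>z\<in>elts U. elts z = {x, y}"
    using assms unfolding grothendieck_universe_def by (elim conjE)
  ultimately obtain A where "A \<in> elts U" "elts A = {p, p}"
    by blast
  then show thesis
    using that by simp
qed

theorem mainTheorem3:
  fixes U U' :: "'v::set_theory"
    and C D :: "('v, 'v) cat"
    and x y :: 'v
  assumes "grothendieck_universe U"
    and "grothendieck_universe U'"
    and "U \<in> elts U'"
    and "(C, x) \<in> Omega_Obj U"
    and "(D, y) \<in> Omega_Obj U"
  shows "Omega_Hom U (C, x) (D, y) \<noteq> {}"
proof -
  let ?P = "prod_cat (op_cat C) D"
  obtain A p where A: "A \<in> elts U" "elts A = {p}"
    using assms(1) by (rule grothendieck_universe_singleton)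
  have cats: "category C" "category D" and xy: "x \<in> Obj C" "y \<in> Obj D"
    using assms(4,5) by (auto simp: Omega_Obj_def small_category_def)
  let ?F = "const_functor ?P (set_cat U) A"
  have "is_functor ?P (set_cat U) ?F"
    using cats A(1)
    by (intro is_functor_const_functor category_prod_cat category_op_cat category_set_cat)
      (simp_all add: set_cat_def Let_def)
  moreover have "p \<in> elts (ObjMap ?F (x, y))"
    using xy A(2) by (simp add: const_functor_def prod_cat_def op_cat_def)
  ultimately have "(?F, p) \<in> Omega_pre U (C, x) (D, y)"
    by (simp add: Omega_pre_def)
  then show ?thesis
    unfolding Omega_Hom_def by (auto intro: quotientI)
qed

end
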